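(* Let $\Theta=\{0,1\}$, $\Phi=\{0,1,2\}$, $H=\{(0,0),(0,1),(1,2)\}\subset\Theta\times\Phi$, $X=\{0,1\}$, and let the data $x\in X$ be determined by $h=(\theta,\phi)\in H$ through $P(x|\theta,\phi)=1$ if $x=[\theta\ne\phi]$ and $0$ otherwise (so $x=0$ for $h=(0,0)$ and $x=1$ for $h=(0,1)$ and $h=(1,2)$), where $[\cdot]$ is $1$ if the enclosed statement is true and $0$ otherwise. Let $H_0=\{(0,0),(0,1)\}$ and $H_1=\{(1,2)\}$. Then: (i) for every nested family $(C_\eta)_{\eta\in[0,1]}$ of (deterministic) critical regions $C_\eta\subseteq X$ for $H_0$, the frequentist confidence $c(x)$ that $H_1$ holds is $0$ for every $x\in X$; consequently, for every prior on $H$, $I(\theta;c)=0$; (ii) for every prior on $H$ giving positive probability to each of the three elements of $H$, $I(\theta;x)>0$, while the apparent Shannon information obtained by treating $c$ as the probability of $\theta=1$ and $1-c$ as the probability of $\theta=0$ is $-\infty$; (iii) for the uniform prior on $H$, $I(\theta;x)=\frac13\log\frac{27}{16}$; and as the prior on $H$ varies, $I(\theta;x)$ can take any positive value up to (and including) $1$ bit, but no larger.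
   Context: A nested family of critical regions for $H_0$ is a family $(C_\eta)_{\eta\in[0,1]}$ of subsets of $X$ such that $\eta_1\le\eta_2$ implies $C_{\eta_1}\supseteq C_{\eta_2}$, and for all $\eta\in[0,1]$ and $h\in H_0$, $P(x\in C_\eta|h)\le1-\eta$. The frequentist confidence that $H_1$ holds given $x$ is $c(x)=\sup(\{\eta\in[0,1]:x\in C_\eta\}\cup\{0\})$. A prior is a probability distribution on $H$; with the likelihood it gives a joint law $P$ of $(\theta,\phi,x)$. For a random variable $z$, the Shannon information in $z$ about $\theta$ is $I(\theta;z)=\mathrm E_P\log\frac{P(\theta|z)}{P(\theta)}$ (mutual information; in bits if the logarithm is to base 2). The apparent Shannon information about $\theta$ in a family of probability distributions $Q(\cdot|x)$ on $\Theta$ is $J(\theta;Q)=\mathrm E_P\log\frac{Q(\theta|x)}{P(\theta)}$, with $\log 0=-\infty$. *)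

theory Defs
  imports "HOL-Probability.Probability"
begin

section \<open>Nested critical regions and frequentist confidence\<close>

text \<open>
  A statistical model assigns to each hypothesis \<open>h\<close> the distribution \<open>L h\<close> of the data given \<open>h\<close>;
  \<open>H0\<close> is the set of null hypotheses. A family over \<open>[0,1]\<close> is a function on all reals of which only
  the values on \<open>[0,1]\<close> are used.
\<close>

definition nested_critical_regions ::
    "'x set \<Rightarrow> ('h \<Rightarrow> 'x pmf) \<Rightarrow> 'h set \<Rightarrow> (real \<Rightarrow> 'x set) \<Rightarrow> bool" where
  "nested_critical_regions X L H0 C \<longleftrightarrow>
     (\<forall>\<eta>\<in>{0..1}. C \<eta> \<subseteq> X) \<and>
     (\<forall>\<eta>1\<in>{0..1}. \<forall>\<eta>2\<in>{0..1}. \<eta>1 \<le> \<eta>2 \<longrightarrow> C \<eta>2 \<subseteq> C \<eta>1) \<and>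
     (\<forall>\<eta>\<in>{0..1}. \<forall>h\<in>H0. measure_pmf.prob (L h) (C \<eta>) \<le> 1 - \<eta>)"

definition confidence :: "(real \<Rightarrow> 'x set) \<Rightarrow> 'x \<Rightarrow> real" where
  "confidence C x = Sup ({\<eta> \<in> {0..1}. x \<in> C \<eta>} \<union> {0})"

section \<open>Shannon information and apparent Shannon information\<close>

text \<open>
  Random variables are functions on the sample space of a probability mass function \<open>P\<close>, so the
  discrete sigma-algebras make all of them measurable.
\<close>

definition shannon_information ::
    "real \<Rightarrow> 'w pmf \<Rightarrow> ('w \<Rightarrow> 't) \<Rightarrow> ('w \<Rightarrow> 'z) \<Rightarrow> real" where
  "shannon_information b P T Z =
     prob_space.mutual_information (measure_pmf P) b (count_space UNIV) (count_space UNIV) T Z"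

text \<open>
  For a finitely supported \<open>P\<close> this is the expectation of \<open>log (P(T | Z) / P(T))\<close>.
\<close>

lemma shannon_information_eq_expectation:
  fixes b :: real and P :: "'w pmf" and T :: "'w \<Rightarrow> 't" and Z :: "'w \<Rightarrow> 'z"
  assumes b: "1 < b" and fin: "finite (set_pmf P)"
  shows "shannon_information b P T Z =
    measure_pmf.expectation P (\<lambda>w. log b
      (\<P>(v in measure_pmf P. T v = T w \<bar> Z v = Z w) / \<P>(v in measure_pmf P. T v = T w)))"
proof -
  let ?S = "count_space UNIV :: 't measure" and ?R = "count_space UNIV :: 'z measure"
  define W where "W = (\<lambda>w. (T w, Z w))"
  define D where "D = distr P ?S T \<Otimes>\<^sub>M distr P ?R Z"
  define N where "N = distr P (?S \<Otimes>\<^sub>M ?R) W"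
  define F where "F = W ` set_pmf P"
  define a where "a p = measure_pmf.prob P {v. W v = p}" for p
  define d where "d p = measure_pmf.prob P {v. T v = fst p} * measure_pmf.prob P {v. Z v = snd p}"
    for p :: "'t \<times> 'z"
  define f where "f p = (\<Sum>q\<in>F. (a q / d q) * indicator {q} p)" for p
  interpret S: prob_space "distr P ?S T"
    by (rule measure_pmf.prob_space_distr) simp
  interpret R: prob_space "distr P ?R Z"
    by (rule measure_pmf.prob_space_distr) simp
  interpret D: pair_prob_space "distr P ?S T" "distr P ?R Z" ..
  have finF: "finite F" unfolding F_def using fin by simp
  have sD: "sets D = sets (?S \<Otimes>\<^sub>M ?R)"
    unfolding D_def by (intro sets_pair_measure_cong) auto
  have sN: "sets N = sets (?S \<Otimes>\<^sub>M ?R)" by (simp add: N_def)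
  have sing: "{q} \<in> sets (?S \<Otimes>\<^sub>M ?R)" for q
  proof -
    have "{fst q} \<times> {snd q} \<in> sets (?S \<Otimes>\<^sub>M ?R)" by (intro pair_measureI) auto
    then show ?thesis by simp
  qed
  have W: "W \<in> measurable (measure_pmf P) (?S \<Otimes>\<^sub>M ?R)"
    unfolding W_def by (intro measurable_Pair) auto
  have emD: "emeasure D {q} = ennreal (d q)" for q
  proof -
    have "emeasure D ({fst q} \<times> {snd q}) = emeasure (distr P ?S T) {fst q} * emeasure (distr P ?R Z) {snd q}"
      unfolding D_def by (intro R.emeasure_pair_measure_Times) auto
    also have "\<dots> = ennreal (d q)"
      by (simp add: emeasure_distr measure_pmf.emeasure_eq_measure d_def ennreal_mult vimage_def)
    finally show ?thesis by simp
  qed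
  have emN: "emeasure N {q} = ennreal (a q)" for q
    unfolding N_def using W sing
    by (simp add: emeasure_distr measure_pmf.emeasure_eq_measure a_def vimage_def)
  have dpos: "d q > 0" if "q \<in> F" for q
  proof -
    from that obtain w where w: "w \<in> set_pmf P" "q = W w" by (auto simp: F_def)
    have "measure_pmf.prob P {v. T v = fst q} > 0" "measure_pmf.prob P {v. Z v = snd q} > 0"
      using w by (auto simp: W_def measure_pmf_posI)
    then show ?thesis by (simp add: d_def)
  qed
  have apos: "a q \<ge> 0" for q by (simp add: a_def)
  have fm: "f \<in> borel_measurable D"
    unfolding f_def using sing sD by (intro borel_measurable_sum borel_measurable_times) auto
  have fnn: "f p \<ge> 0" for p
    unfolding f_def using apos dpos by (intro sum_nonneg) (auto simp: less_imp_le)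
  have fF: "f p = a p / d p" if "p \<in> F" for p
    unfolding f_def using finF that by (subst sum.remove[of _ p]) (auto intro!: sum.neutral simp: indicator_def)
  have dens: "density D f = N"
  proof (rule measure_eqI)
    show "sets (density D f) = sets N" by (simp add: sD sN)
    fix A assume "A \<in> sets (density D f)"
    then have A: "A \<in> sets D" by simp
    have "emeasure (density D f) A = (\<integral>\<^sup>+p. ennreal (f p) * indicator A p \<partial>D)"
      using fm A by (subst emeasure_density) auto
    also have "\<dots> = (\<integral>\<^sup>+p. (\<Sum>q\<in>F \<inter> A. ennreal (a q / d q) * indicator {q} p) \<partial>D)"
    proof (intro nn_integral_cong)
      fix p
      have fp0: "f p = 0" if "p \<notin> F"
        unfolding f_def using that by (intro sum.neutral) (auto simp: indicator_def)
      have R: "(\<Sum>q\<in>F \<inter> A. ennreal (a q / d q) * indicator {q} p)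
          = (if p \<in> F \<inter> A then ennreal (a p / d p) else 0)"
      proof -
        have "(\<Sum>q\<in>F \<inter> A. ennreal (a q / d q) * indicator {q} p)
          = (\<Sum>q\<in>F \<inter> A. if q = p then ennreal (a q / d q) else 0)"
          by (intro sum.cong) (auto simp: indicator_def)
        then show ?thesis using finF by simp
      qed
      show "ennreal (f p) * indicator A p = (\<Sum>q\<in>F \<inter> A. ennreal (a q / d q) * indicator {q} p)"
        unfolding R using fF fp0 by (cases "p \<in> F") (auto simp: indicator_def)
    qed
    also have "\<dots> = (\<Sum>q\<in>F \<inter> A. \<integral>\<^sup>+p. ennreal (a q / d q) * indicator {q} p \<partial>D)"
      using sing sD by (intro nn_integral_sum) auto
    also have "\<dots> = (\<Sum>q\<in>F \<inter> A. ennreal (a q))"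
    proof (intro sum.cong refl)
      fix q assume q: "q \<in> F \<inter> A"
      have "(\<integral>\<^sup>+p. ennreal (a q / d q) * indicator {q} p \<partial>D) = ennreal (a q / d q) * ennreal (d q)"
        using sing sD emD by (subst nn_integral_cmult_indicator) auto
      also have "\<dots> = ennreal (a q)"
        using q dpos[of q] apos[of q] by (subst ennreal_mult[symmetric]) auto
      finally show "(\<integral>\<^sup>+p. ennreal (a q / d q) * indicator {q} p \<partial>D) = ennreal (a q)" .
    qed
    also have "\<dots> = (\<Sum>q\<in>F \<inter> A. emeasure N {q})" by (simp add: emN)
    also have "\<dots> = emeasure N (F \<inter> A)"
      using sing sN finF by (subst emeasure_eq_sum_singleton[symmetric]) auto
    also have "\<dots> = emeasure N A"
    proof -
      have FA: "F \<inter> A \<in> sets (?S \<Otimes>\<^sub>M ?R)"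
      proof -
        have "F \<inter> A = (\<Union>q\<in>F \<inter> A. {q})" by auto
        also have "\<dots> \<in> sets (?S \<Otimes>\<^sub>M ?R)" using finF sing by (intro sets.finite_UN) auto
        finally show ?thesis .
      qed
      have "emeasure P (W -` (F \<inter> A)) = emeasure P (W -` A)"
        by (intro emeasure_eq_AE) (auto simp: AE_measure_pmf_iff F_def)
      then show ?thesis
        using FA A sD W by (simp add: N_def emeasure_distr)
    qed
    finally show "emeasure (density D f) A = emeasure N A" .
  qed
  have lm: "(\<lambda>p. log b (f p)) \<in> borel_measurable D" using fm by simp
  have "shannon_information b P T Z = KL_divergence b D N"
    unfolding shannon_information_def prob_space.mutual_information_def[OF prob_space_measure_pmf] D_def N_def W_def ..
  also have "\<dots> = (\<integral>p. f p * log b (f p) \<partial>D)"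
    unfolding dens[symmetric] D_def[symmetric]
    using D.P.KL_density[of b f] b fm fnn by (simp add: D_def)
  also have "\<dots> = (\<integral>p. log b (f p) \<partial>N)"
    unfolding dens[symmetric] using lm fm fnn by (subst integral_density) auto
  also have "\<dots> = (\<integral>w. log b (f (W w)) \<partial>P)"
    unfolding N_def using W lm sD
    by (subst integral_distr) (auto cong: measurable_cong_sets)
  also have "\<dots> = measure_pmf.expectation P (\<lambda>w. log b
      (\<P>(v in measure_pmf P. T v = T w \<bar> Z v = Z w) / \<P>(v in measure_pmf P. T v = T w)))"
  proof (intro integral_cong_AE)
    show "AE w in P. log b (f (W w)) = log b
      (\<P>(v in measure_pmf P. T v = T w \<bar> Z v = Z w) / \<P>(v in measure_pmf P. T v = T w))"
      by (auto simp: AE_measure_pmf_iff fF F_def)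
        (simp add: a_def d_def W_def cond_prob_def mult.commute)
  qed auto
  finally show ?thesis .
qed

text \<open>
  The library has \<open>log b 0 = 0\<close>; here the value at \<open>0\<close> has to be minus infinity, so the expectation is
  taken in the extended reals, as the difference of the integrals of the positive and the negative
  part (\<open>e2ennreal\<close> sends negative arguments to \<open>0\<close>).
\<close>

definition ext_log :: "real \<Rightarrow> real \<Rightarrow> ereal" where
  "ext_log b r = (if r = 0 then -\<infinity> else ereal (log b r))"

definition ext_expectation :: "'w pmf \<Rightarrow> ('w \<Rightarrow> ereal) \<Rightarrow> ereal" where
  "ext_expectation P f =
     enn2ereal (\<integral>\<^sup>+w. e2ennreal (f w) \<partial>P) - enn2ereal (\<integral>\<^sup>+w. e2ennreal (- f w) \<partial>P)"

definition apparent_information ::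
    "real \<Rightarrow> 'w pmf \<Rightarrow> ('w \<Rightarrow> 't) \<Rightarrow> ('w \<Rightarrow> 'x) \<Rightarrow> ('x \<Rightarrow> 't pmf) \<Rightarrow> ereal" where
  "apparent_information b P T D Q =
     ext_expectation P (\<lambda>w. ext_log b (pmf (Q (D w)) (T w) / \<P>(v in measure_pmf P. T v = T w)))"

section \<open>The example\<close>

definition Theta :: "nat set" where "Theta = {0, 1}"
definition Phi :: "nat set" where "Phi = {0, 1, 2}"
definition Hyp :: "(nat \<times> nat) set" where "Hyp = {(0, 0), (0, 1), (1, 2)}"
definition Hyp0 :: "(nat \<times> nat) set" where "Hyp0 = {(0, 0), (0, 1)}"
definition Hyp1 :: "(nat \<times> nat) set" where "Hyp1 = {(1, 2)}"
definition Data :: "nat set" where "Data = {0, 1}"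

lemma Hyp_subset: "Hyp \<subseteq> Theta \<times> Phi"
  by (auto simp: Hyp_def Theta_def Phi_def)

lemma Hyp_partition: "Hyp = Hyp0 \<union> Hyp1" "Hyp0 \<inter> Hyp1 = {}"
  by (auto simp: Hyp_def Hyp0_def Hyp1_def)

definition lik :: "nat \<times> nat \<Rightarrow> nat pmf" where
  "lik h = return_pmf (of_bool (fst h \<noteq> snd h))"

lemma pmf_lik: "pmf (lik (\<theta>, \<phi>)) x = (if x = of_bool (\<theta> \<noteq> \<phi>) then 1 else 0)"
  by (auto simp: lik_def)

definition joint_law :: "(nat \<times> nat) pmf \<Rightarrow> (nat \<times> nat \<times> nat) pmf" where
  "joint_law prior = bind_pmf prior (\<lambda>(\<theta>, \<phi>). map_pmf (\<lambda>x. (\<theta>, \<phi>, x)) (lik (\<theta>, \<phi>)))"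

definition theta_rv :: "nat \<times> nat \<times> nat \<Rightarrow> nat" where "theta_rv = (\<lambda>(\<theta>, \<phi>, x). \<theta>)"
definition data_rv :: "nat \<times> nat \<times> nat \<Rightarrow> nat" where "data_rv = (\<lambda>(\<theta>, \<phi>, x). x)"

definition prior_on_Hyp :: "(nat \<times> nat) pmf \<Rightarrow> bool" where
  "prior_on_Hyp prior \<longleftrightarrow> set_pmf prior \<subseteq> Hyp"

text \<open>
  The confidence read as the probability of \<open>\<theta> = 1\<close>, its complement as that of \<open>\<theta> = 0\<close>
  (confidences always lie in \<open>[0,1]\<close>, so \<open>bernoulli_pmf\<close> does not truncate).
\<close>

definition confidence_dist :: "(real \<Rightarrow> nat set) \<Rightarrow> nat \<Rightarrow> nat pmf" where
  "confidence_dist C x = map_pmf of_bool (bernoulli_pmf (confidence C x))"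

lemma confidence_bounds: "0 \<le> confidence C x" "confidence C x \<le> 1"
proof -
  show "0 \<le> confidence C x"
    unfolding confidence_def by (intro cSup_upper bdd_aboveI[of _ 1]) auto
  show "confidence C x \<le> 1"
    unfolding confidence_def by (intro cSup_least) auto
qed

lemma pmf_confidence_dist:
  "pmf (confidence_dist C x) 1 = confidence C x"
  "pmf (confidence_dist C x) 0 = 1 - confidence C x"
proof -
  have "inj (of_bool :: bool \<Rightarrow> nat)" by (auto simp: inj_def)
  from pmf_map_inj'[OF this, of "bernoulli_pmf (confidence C x)" True]
    pmf_map_inj'[OF this, of "bernoulli_pmf (confidence C x)" False]
  show "pmf (confidence_dist C x) 1 = confidence C x"
    "pmf (confidence_dist C x) 0 = 1 - confidence C x"
    by (simp_all add: confidence_dist_def confidence_bounds)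
qed

end

theory Submission
  imports Defs "HOL-Real_Asymp.Real_Asymp"
begin

text \<open>
  Each observation is the sure consequence of some null hypothesis: \<open>(0,0)\<close> produces \<open>0\<close> and
  \<open>(0,1)\<close> produces \<open>1\<close>. A critical region \<open>C \<eta>\<close> with \<open>\<eta> > 0\<close> must therefore contain no
  observation at all, and the confidence in \<open>\<theta> = 1\<close> is \<open>0\<close> whatever is observed. A constant carries no information;
  taken at face value it gives probability \<open>0\<close> to the event \<open>\<theta> = 1\<close>, whose true probability is
  positive, so the apparent information is \<open>-\<infinity>\<close> (\<open>confidence_zero\<close>, \<open>shannon_information_AE_const\<close>,
  \<open>apparent_information_minus_infinity\<close>).

  The data themselves are informative. The prior is a point \<open>(p, q, r)\<close> of the simplex, with weights
  on \<open>(0,0)\<close>, \<open>(0,1)\<close>, \<open>(1,2)\<close>, and \<open>shannon_information_data\<close> writes \<open>I(\<theta>;x)\<close> as an explicit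
  function \<open>example_information\<close> of it. The rest is calculus. The inequality \<open>ln t \<le> t - 1\<close>, applied
  to each term, gives \<open>I(\<theta>;x) \<ge> p r / ln b\<close>, which settles positivity; replacing the posterior by
  certainty bounds \<open>I(\<theta>;x)\<close> by the entropy of \<open>\<theta>\<close>, which is at most one bit. On the edge \<open>q = 0\<close>
  the data determine \<open>\<theta>\<close>, so that the information is the binary entropy of \<open>r\<close>; it tends to \<open>0\<close> with
  \<open>r\<close> and equals one bit at \<open>r = 1/2\<close>, and the intermediate value theorem yields every value
  in between.
\<close>

section \<open>The joint law of the example\<close>

definition outcome :: "nat \<times> nat \<Rightarrow> nat \<times> nat \<times> nat" where
  "outcome h = (fst h, snd h, of_bool (fst h \<noteq> snd h))"

lemma joint_law_eq_map: "joint_law prior = map_pmf outcome prior"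
  by (auto simp: joint_law_def lik_def map_pmf_def bind_return_pmf outcome_def
      case_prod_beta intro!: bind_pmf_cong)

lemma set_joint_law: "set_pmf (joint_law prior) = outcome ` set_pmf prior"
  by (simp add: joint_law_eq_map)

lemma finite_joint_law: "prior_on_Hyp prior \<Longrightarrow> finite (set_pmf (joint_law prior))"
  by (auto simp: set_joint_law prior_on_Hyp_def Hyp_def intro: finite_subset)

lemma data_in_Data: "w \<in> set_pmf (joint_law prior) \<Longrightarrow> data_rv w \<in> Data"
  by (auto simp: set_joint_law outcome_def data_rv_def Data_def of_bool_def split: if_splits)

lemma expectation_joint_law:
  fixes f :: "nat \<times> nat \<times> nat \<Rightarrow> real"
  assumes "prior_on_Hyp prior"
  shows "measure_pmf.expectation (joint_law prior) f =
    pmf prior (0, 0) * f (0, 0, 0) + pmf prior (0, 1) * f (0, 1, 1) + pmf prior (1, 2) * f (1, 2, 1)"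
proof -
  have "measure_pmf.expectation (joint_law prior) f = (\<Sum>h\<in>Hyp. pmf prior h *\<^sub>R f (outcome h))"
    unfolding joint_law_eq_map integral_map_pmf
    using assms by (intro integral_measure_pmf) (auto simp: prior_on_Hyp_def Hyp_def)
  then show ?thesis by (simp add: Hyp_def outcome_def)
qed

lemma prob_joint_law:
  assumes "prior_on_Hyp prior"
  shows "measure_pmf.prob (joint_law prior) A =
    pmf prior (0, 0) * indicator A (0, 0, 0) + pmf prior (0, 1) * indicator A (0, 1, 1)
      + pmf prior (1, 2) * indicator A (1, 2, 1)"
  using expectation_joint_law[OF assms, of "indicator A"] by simp

lemma prior_total:
  assumes "prior_on_Hyp prior"
  shows "pmf prior (0, 0) + pmf prior (0, 1) + pmf prior (1, 2) = 1"
  using prob_joint_law[OF assms, of UNIV] by simp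

section \<open>The confidence vanishes and is uninformative\<close>

lemma confidence_zero:
  assumes C: "nested_critical_regions Data lik Hyp0 C" and x: "x \<in> Data"
  shows "confidence C x = 0"
proof -
  have "\<eta> = 0" if \<eta>: "\<eta> \<in> {0..1}" "x \<in> C \<eta>" for \<eta>
  proof -
    \<comment> \<open>The null hypothesis under which \<open>x\<close> is certain.\<close>
    have h: "(0, x) \<in> Hyp0" "lik (0, x) = return_pmf x"
      using x by (auto simp: Data_def Hyp0_def lik_def)
    have "measure_pmf.prob (lik (0, x)) (C \<eta>) \<le> 1 - \<eta>"
      using C \<eta>(1) h(1) unfolding nested_critical_regions_def by blast
    then show ?thesis using h(2) \<eta> by simp
  qed
  then have "{\<eta> \<in> {0..1}. x \<in> C \<eta>} \<union> {0} = {0}" by auto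
  then show ?thesis unfolding confidence_def by (metis cSup_singleton)
qed

text \<open>Conditioning on an almost surely constant variable leaves every probability unchanged, so each
  logarithm in the expectation is \<open>log 1\<close>.\<close>

lemma shannon_information_AE_const:
  assumes b: "1 < b" and fin: "finite (set_pmf P)" and Z: "\<And>w. w \<in> set_pmf P \<Longrightarrow> Z w = c"
  shows "shannon_information b P T Z = 0"
proof -
  have "log b (\<P>(v in measure_pmf P. T v = T w \<bar> Z v = Z w) / \<P>(v in measure_pmf P. T v = T w)) = 0"
    if w: "w \<in> set_pmf P" for w
  proof -
    have "measure_pmf.prob P {v. T v = T w \<and> Z v = Z w} = measure_pmf.prob P {v. T v = T w}"
      by (intro measure_pmf.finite_measure_eq_AE) (auto simp: AE_measure_pmf_iff Z w)
    moreover have "measure_pmf.prob P {v. Z v = Z w} = 1"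
      by (intro measure_pmf.prob_eq_1[THEN iffD2]) (auto simp: AE_measure_pmf_iff Z w)
    moreover have "measure_pmf.prob P {v. T v = T w} \<noteq> 0"
      using w by (auto simp: measure_pmf_zero_iff)
    ultimately show ?thesis by (simp add: cond_prob_def)
  qed
  then have "measure_pmf.expectation P (\<lambda>w. log b
      (\<P>(v in measure_pmf P. T v = T w \<bar> Z v = Z w) / \<P>(v in measure_pmf P. T v = T w)))
    = measure_pmf.expectation P (\<lambda>w. 0)"
    by (intro integral_cong_AE) (auto simp: AE_measure_pmf_iff)
  then show ?thesis by (simp add: shannon_information_eq_expectation[OF b fin])
qed

text \<open>One atom where the asserted probability of the truth is \<open>0\<close> makes the negative part infinite;
  on finite support the positive part is finite, so nothing can compensate.\<close>

lemma apparent_information_minus_infinity: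
  assumes fin: "finite (set_pmf P)" and w: "w \<in> set_pmf P" and Q: "pmf (Q (D w)) (T w) = 0"
  shows "apparent_information b P T D Q = -\<infinity>"
proof -
  define f where "f v = ext_log b (pmf (Q (D v)) (T v) / \<P>(u in measure_pmf P. T u = T v))" for v
  have "f v \<noteq> \<infinity>" for v by (simp add: f_def ext_log_def)
  then have fv: "e2ennreal (f v) < \<top>" for v
    by (cases "f v") (auto simp: e2ennreal_neg)
  have mass: "e * ennreal (pmf P v) < \<top>" if "e < \<top>" for e v
    using that by (simp add: ennreal_mult_less_top)
  have pos: "(\<integral>\<^sup>+v. e2ennreal (f v) \<partial>P) < \<top>"
    unfolding nn_integral_measure_pmf_finite[OF fin zero_le] ennreal_sum_less_top[OF fin]
    by (intro ballI mass fv)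
  have "e2ennreal (- f w) = \<top>"
    using Q by (simp add: f_def ext_log_def)
  then have "e2ennreal (- f w) * ennreal (pmf P w) = \<top>"
    using w by (simp add: ennreal_mult_eq_top_iff set_pmf_iff)
  then have neg: "(\<integral>\<^sup>+v. e2ennreal (- f v) \<partial>P) = \<top>"
    unfolding nn_integral_measure_pmf_finite[OF fin zero_le] ennreal_sum_eq_top[OF fin]
    using w by (rule bexI)
  show ?thesis
    unfolding apparent_information_def ext_expectation_def f_def[symmetric] neg
    using pos by (cases "\<integral>\<^sup>+v. e2ennreal (f v) \<partial>P") simp_all
qed

section \<open>The information in the data as a function of the prior\<close>

definition example_information :: "real \<Rightarrow> real \<Rightarrow> real \<Rightarrow> real \<Rightarrow> real" where
  "example_information b p q r =
     p * log b (1 / (p + q)) + q * log b (q / ((q + r) * (p + q))) + r * log b (1 / (q + r))"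

lemma shannon_information_data:
  assumes b: "1 < b" and prior: "prior_on_Hyp prior"
  shows "shannon_information b (joint_law prior) theta_rv data_rv =
    example_information b (pmf prior (0, 0)) (pmf prior (0, 1)) (pmf prior (1, 2))"
proof -
  have "p * log b (p / p / s) = p * log b (1 / s)" for p s :: real by (cases "p = 0") auto
  moreover have "r * log b (r / (q + r) / r) = r * log b (1 / (q + r))" for q r :: real
    by (cases "r = 0") auto
  ultimately show ?thesis
    unfolding shannon_information_eq_expectation[OF b finite_joint_law[OF prior]]
      expectation_joint_law[OF prior] cond_prob_def example_information_def
    by (simp add: prob_joint_law[OF prior] theta_rv_def data_rv_def)
qed

text \<open>The bound \<open>ln t \<le> t - 1\<close> in the form in which it enters each term of the information:
  \<open>u\<close> is the prior divided by the posterior probability of \<open>\<theta>\<close>, and \<open>p\<close> the weight of the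
  hypothesis.\<close>

lemma log_term_lower:
  fixes b p u :: real
  assumes "1 < b" "0 \<le> p" "0 < u"
  shows "(p - p * u) / ln b \<le> p * log b (1 / u)"
proof -
  have "1 - u \<le> ln (1 / u)" using ln_le_minus_one[OF assms(3)] assms(3) by (simp add: ln_div)
  then have "p * (1 - u) \<le> p * ln (1 / u)" using assms(2) by (rule mult_left_mono)
  then show ?thesis using assms(1) by (simp add: log_def divide_right_mono algebra_simps)
qed

text \<open>Subtracting the term-wise bounds leaves \<open>1 - p (p + q) - (q + r) (p + q) - r (q + r)\<close>, which
  factors as \<open>p r\<close> on the simplex.\<close>

lemma example_information_lower:
  assumes b: "1 < b" and pos: "0 < p" "0 < q" "0 < r" and sum: "p + q + r = 1"
  shows "p * r / ln b \<le> example_information b p q r"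
proof -
  have "(p - p * (p + q)) / ln b \<le> p * log b (1 / (p + q))"
    using b pos by (intro log_term_lower) auto
  moreover have "(q - q * ((q + r) * (p + q) / q)) / ln b \<le> q * log b (1 / ((q + r) * (p + q) / q))"
    using b pos by (intro log_term_lower) auto
  moreover have "(r - r * (q + r)) / ln b \<le> r * log b (1 / (q + r))"
    using b pos by (intro log_term_lower) auto
  moreover have "p * r = (p - p * (p + q)) + (q - (q + r) * (p + q)) + (r - r * (q + r))"
  proof -
    have "r = 1 - p - q" using sum by simp
    show ?thesis unfolding \<open>r = 1 - p - q\<close> by (simp add: algebra_simps)
  qed
  then have "p * r / ln b = (p - p * (p + q)) / ln b + (q - (q + r) * (p + q)) / ln b
      + (r - r * (q + r)) / ln b"
    by (simp only: add_divide_distrib)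
  ultimately show ?thesis using pos by (simp add: example_information_def)
qed

section \<open>Range of the information\<close>

definition binary_entropy :: "real \<Rightarrow> real" where
  "binary_entropy r = (1 - r) * log 2 (1 / (1 - r)) + r * log 2 (1 / r)"

text \<open>Comparison with a fair coin: \<open>u log (1 / (2 u)) \<le> (1/2 - u) / ln 2\<close> for each of the two
  weights, and these right-hand sides cancel.\<close>

lemma binary_entropy_le_1:
  assumes "0 \<le> r" "r \<le> 1"
  shows "binary_entropy r \<le> 1"
proof -
  have term_le: "u * log 2 (1 / u) \<le> u + (1 / 2 - u) / ln 2" if "0 \<le> u" for u :: real
  proof (cases "u = 0")
    case False
    with that have u: "0 < u" by simp
    have "ln (1 / (2 * u)) \<le> 1 / (2 * u) - 1" using u by (intro ln_le_minus_one) simp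
    then have "u * ln (1 / (2 * u)) \<le> u * (1 / (2 * u) - 1)" using u by (intro mult_left_mono) auto
    also have "\<dots> = 1 / 2 - u" using u by (simp add: field_simps)
    finally have "u * ln (1 / (2 * u)) / ln 2 \<le> (1 / 2 - u) / ln 2" by (intro divide_right_mono) auto
    moreover have "ln (1 / u) = ln 2 + ln (1 / (2 * u))" using u by (simp add: ln_div ln_mult)
    ultimately have "u * ln (1 / u) / ln 2 \<le> u * ln 2 / ln 2 + (1 / 2 - u) / ln 2"
      by (simp add: distrib_left add_divide_distrib)
    then show ?thesis by (simp add: log_def)
  qed simp
  from term_le[of r] term_le[of "1 - r"] assms show ?thesis
    by (simp add: binary_entropy_def diff_divide_distrib)
qed

text \<open>The information about \<open>\<theta>\<close> is at most the entropy of \<open>\<theta>\<close>: the posterior probabilities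
  \<open>q / (q + r)\<close> and \<open>r / (q + r)\<close> are replaced by \<open>1\<close>.\<close>

lemma example_information_le_entropy:
  assumes nonneg: "0 \<le> p" "0 \<le> q" "0 \<le> r" and sum: "p + q + r = 1"
  shows "example_information 2 p q r \<le> binary_entropy r"
proof -
  have pq: "1 - r = p + q" using sum by simp
  have "q * log 2 (q / ((q + r) * (p + q))) \<le> q * log 2 (1 / (p + q))"
  proof (cases "q = 0")
    case False
    with nonneg have "q / ((q + r) * (p + q)) \<le> 1 / (p + q)" "0 < q / ((q + r) * (p + q))"
      by (auto simp: divide_simps)
    then show ?thesis using nonneg by (intro mult_left_mono log_mono) auto
  qed simp
  moreover have "r * log 2 (1 / (q + r)) \<le> r * log 2 (1 / r)"
  proof (cases "r = 0")
    case False
    with nonneg show ?thesis by (intro mult_left_mono log_mono) (auto simp: divide_simps)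
  qed simp
  ultimately show ?thesis
    unfolding binary_entropy_def example_information_def pq by (simp add: algebra_simps)
qed

text \<open>The summand \<open>r log (1 / r)\<close> has the form \<open>0 \<cdot> \<infinity>\<close> at \<open>r = 0\<close>. The intermediate
  value theorem is therefore applied on an interval away from \<open>0\<close>, whose left end is supplied by the
  limit.\<close>

lemma binary_entropy_surj:
  assumes v: "0 < v" "v \<le> 1"
  obtains r where "0 < r" "r \<le> 1 / 2" "binary_entropy r = v"
proof -
  have "(binary_entropy \<longlongrightarrow> 0) (at_right 0)"
    unfolding binary_entropy_def log_def by real_asymp
  then have "eventually (\<lambda>r. binary_entropy r < v) (at_right 0)"
    using v(1) by (rule order_tendstoD)
  moreover have "eventually (\<lambda>r::real. r \<in> {0<..<1/2}) (at_right 0)"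
    by (rule eventually_at_right_real) simp
  ultimately obtain s where s: "binary_entropy s < v" "0 < s" "s < 1 / 2"
    using eventually_happens[OF eventually_conj] by (metis (no_types, lifting) greaterThanLessThan_iff trivial_limit_at_right_real)
  have half: "binary_entropy (1 / 2) = 1" by (simp add: binary_entropy_def)
  have "continuous_on {s..1 / 2} binary_entropy"
    unfolding binary_entropy_def log_def using s by (intro continuous_intros) auto
  then obtain r where "s \<le> r" "r \<le> 1 / 2" "binary_entropy r = v"
    using IVT'[of binary_entropy s v "1 / 2"] s v half by auto
  with s show ?thesis by (intro that) auto
qed

text \<open>Weight \<open>0\<close> on \<open>(0,1)\<close> makes the data determine \<open>\<theta>\<close>.\<close>

lemma prior_attaining_binary_entropy:
  assumes r: "0 \<le> r" "r \<le> 1"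
  obtains prior where "prior_on_Hyp prior"
    "shannon_information 2 (joint_law prior) theta_rv data_rv = binary_entropy r"
proof
  let ?prior = "map_pmf (\<lambda>t. if t then (1, 2) else (0, 0)) (bernoulli_pmf r) :: (nat \<times> nat) pmf"
  let ?h = "\<lambda>t. if t then (1, 2) else (0, 0) :: nat \<times> nat"
  have inj: "inj ?h" by (auto simp: inj_def)
  have "pmf ?prior (1, 2) = r" "pmf ?prior (0, 0) = 1 - r"
    using pmf_map_inj'[OF inj, of "bernoulli_pmf r" True] pmf_map_inj'[OF inj, of "bernoulli_pmf r" False] r
    by simp_all
  moreover have "pmf ?prior (0, 1) = 0" by (auto simp: pmf_eq_0_set_pmf)
  moreover show on: "prior_on_Hyp ?prior" by (auto simp: prior_on_Hyp_def Hyp_def)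
  ultimately show "shannon_information 2 (joint_law ?prior) theta_rv data_rv = binary_entropy r"
    by (simp add: shannon_information_data example_information_def binary_entropy_def)
qed

section \<open>Information and confidence compared\<close>

theorem mainTheorem5:
  fixes b :: real
  assumes "1 < b"
  shows
    "(\<forall>C. nested_critical_regions Data lik Hyp0 C \<longrightarrow>
        (\<forall>x\<in>Data. confidence C x = 0) \<and>
        (\<forall>prior. prior_on_Hyp prior \<longrightarrow>
           shannon_information b (joint_law prior) theta_rv (confidence C \<circ> data_rv) = 0)) \<and>
     (\<forall>prior. prior_on_Hyp prior \<and> (\<forall>h\<in>Hyp. 0 < pmf prior h) \<longrightarrow>
        0 < shannon_information b (joint_law prior) theta_rv data_rv \<and>
        (\<forall>C. nested_critical_regions Data lik Hyp0 C \<longrightarrow>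
           apparent_information b (joint_law prior) theta_rv data_rv (confidence_dist C) = -\<infinity>)) \<and>
     shannon_information b (joint_law (pmf_of_set Hyp)) theta_rv data_rv = 1 / 3 * log b (27 / 16) \<and>
     (\<forall>v. 0 < v \<and> v \<le> 1 \<longrightarrow>
        (\<exists>prior. prior_on_Hyp prior \<and>
           shannon_information 2 (joint_law prior) theta_rv data_rv = v)) \<and>
     (\<forall>prior. prior_on_Hyp prior \<longrightarrow>
        shannon_information 2 (joint_law prior) theta_rv data_rv \<le> 1)"
proof (intro conjI allI impI ballI)
  fix C x assume "nested_critical_regions Data lik Hyp0 C" "x \<in> Data"
  then show "confidence C x = 0" by (rule confidence_zero)
next
  fix C and prior :: "(nat \<times> nat) pmf"
  assume "nested_critical_regions Data lik Hyp0 C" "prior_on_Hyp prior"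
  then show "shannon_information b (joint_law prior) theta_rv (confidence C \<circ> data_rv) = 0"
    using assms by (intro shannon_information_AE_const[where c = 0] finite_joint_law)
      (auto intro: confidence_zero data_in_Data)
next
  fix prior :: "(nat \<times> nat) pmf"
  assume prior: "prior_on_Hyp prior \<and> (\<forall>h\<in>Hyp. 0 < pmf prior h)"
  then have pos: "0 < pmf prior (0, 0)" "0 < pmf prior (0, 1)" "0 < pmf prior (1, 2)"
    by (auto simp: Hyp_def)
  have "0 < pmf prior (0, 0) * pmf prior (1, 2) / ln b" using assms pos by simp
  also have "\<dots> \<le> shannon_information b (joint_law prior) theta_rv data_rv"
    using assms prior pos prior_total
    by (simp add: shannon_information_data example_information_lower)
  finally show "0 < shannon_information b (joint_law prior) theta_rv data_rv" .
next
  fix prior :: "(nat \<times> nat) pmf" and C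
  assume prior: "prior_on_Hyp prior \<and> (\<forall>h\<in>Hyp. 0 < pmf prior h)"
    and C: "nested_critical_regions Data lik Hyp0 C"
  have "(1, 2) \<in> set_pmf prior" using prior by (simp add: Hyp_def set_pmf_iff)
  then have "outcome (1, 2) \<in> set_pmf (joint_law prior)" unfolding set_joint_law by (rule imageI)
  moreover have "pmf (confidence_dist C (data_rv (outcome (1, 2)))) (theta_rv (outcome (1, 2))) = 0"
    using pmf_confidence_dist(1)[of C 1] confidence_zero[OF C, of 1]
    by (simp add: outcome_def data_rv_def theta_rv_def Data_def)
  ultimately show "apparent_information b (joint_law prior) theta_rv data_rv (confidence_dist C) = -\<infinity>"
    using prior by (intro apparent_information_minus_infinity finite_joint_law) auto
next
  have fin: "finite Hyp" "Hyp \<noteq> {}" and card: "card Hyp = 3" by (auto simp: Hyp_def)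
  have "prior_on_Hyp (pmf_of_set Hyp)" using fin by (simp add: prior_on_Hyp_def)
  moreover have "pmf (pmf_of_set Hyp) h = 1 / 3" if "h \<in> Hyp" for h
    using fin card that by simp
  moreover have "(0, 0) \<in> Hyp" "(0, 1) \<in> Hyp" "(1, 2) \<in> Hyp" by (auto simp: Hyp_def)
  ultimately have "shannon_information b (joint_law (pmf_of_set Hyp)) theta_rv data_rv
      = example_information b (1 / 3) (1 / 3) (1 / 3)"
    using assms by (simp only: shannon_information_data)
  also have "\<dots> = 1 / 3 * (log b (3 / 2) + log b (3 / 4) + log b (3 / 2))"
    by (simp add: example_information_def)
  also have "\<dots> = 1 / 3 * log b (27 / 16)"
    using assms by (simp flip: log_mult_pos)
  finally show "shannon_information b (joint_law (pmf_of_set Hyp)) theta_rv data_rv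
      = 1 / 3 * log b (27 / 16)" .
next
  fix v :: real assume "0 < v \<and> v \<le> 1"
  then obtain r where "0 < r" "r \<le> 1 / 2" "binary_entropy r = v"
    using binary_entropy_surj by blast
  then show "\<exists>prior. prior_on_Hyp prior \<and>
      shannon_information 2 (joint_law prior) theta_rv data_rv = v"
    using prior_attaining_binary_entropy[of r] by force
next
  fix prior :: "(nat \<times> nat) pmf" assume prior: "prior_on_Hyp prior"
  have "shannon_information 2 (joint_law prior) theta_rv data_rv \<le> binary_entropy (pmf prior (1, 2))"
    using prior prior_total[OF prior]
    by (simp add: shannon_information_data example_information_le_entropy)
  also have "\<dots> \<le> 1" by (intro binary_entropy_le_1 pmf_le_1) simp
  finally show "shannon_information 2 (joint_law prior) theta_rv data_rv \<le> 1" .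
qed

end
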